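(* Let $k>0$, let $n\ge 1$ be an integer, and let $U:\mathbb{R}^n\to\mathbb{R}$ be a smooth function which is bounded from below; write $U_{\inf}:=\inf_{q\in\mathbb{R}^n}U(q)>-\infty$ and $\mathcal{E}(q,\dot q):=\frac12|\dot q|^2+U(q)$. Then every (maximal) solution $t\mapsto q(t)\in\mathbb{R}^n$ of the dissipative equation $$\ddot q=-k\dot q-\nabla U(q)$$ is defined for all $t\in\mathbb{R}$, and for every $t_0\in\mathbb{R}$ the following estimates hold. In the future: $$\frac12|\dot q(t)|^2\le \frac12|\dot q(t_0)|^2+U(q(t_0))-U_{\inf}\quad\text{for all }t\ge t_0,$$ $$\int_{t_0}^{+\infty}|\dot q(s)|^2\,ds<+\infty.$$ In the past: $$\mathcal{E}(q(t),\dot q(t))-U_{\inf}\le e^{2k(t_0-t)}\Bigl(\mathcal{E}(q(t_0),\dot q(t_0))-U_{\inf}\Bigr)\quad\text{for all }t\le t_0,$$ $$|\dot q(t)|^2\le e^{2k(t_0-t)}\Bigl(|\dot q(t_0)|^2+2U(q(t_0))-2U_{\inf}\Bigr)\quad\text{for all }t\le t_0.$$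
   Context: Here $|\cdot|$ is the Euclidean norm on $\mathbb{R}^n$, $\nabla U$ is the gradient of $U$, and dots denote derivatives with respect to the time variable $t$. "Solution" means a solution of the ODE on its maximal interval of existence. *)

theory Defs
  imports "HOL-Analysis.Analysis"
begin

text \<open>
  \<open>ck m f\<close> means that \<open>f\<close> is of class $C^m$ on the whole space: differentiating along
  an arbitrary fixed vector \<open>v\<close> covers all partial derivatives.
\<close>

fun ck :: "nat \<Rightarrow> ('a::euclidean_space \<Rightarrow> real) \<Rightarrow> bool" where
  "ck 0 f \<longleftrightarrow> continuous_on UNIV f"
| "ck (Suc m) f \<longleftrightarrow>
     (\<forall>x. f differentiable (at x)) \<and> (\<forall>v. ck m (\<lambda>x. frechet_derivative f (at x) v))"

definition smooth :: "('a::euclidean_space \<Rightarrow> real) \<Rightarrow> bool" where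
  "smooth f \<longleftrightarrow> (\<forall>m. ck m f)"

text \<open>Only meaningful where \<open>U\<close> is differentiable; the gradient is then unique.\<close>

definition gradient :: "('a::euclidean_space \<Rightarrow> real) \<Rightarrow> 'a \<Rightarrow> 'a" where
  "gradient U x = (THE D. GDERIV U x :> D)"

definition velocity :: "(real \<Rightarrow> 'a::euclidean_space) \<Rightarrow> real \<Rightarrow> 'a" where
  "velocity q t = vector_derivative q (at t)"

text \<open>
  A solution is a pair of an open interval \<open>I\<close> (possibly unbounded) and a function \<open>q\<close>. Since
  functions are total, the values of \<open>q\<close> outside \<open>I\<close> are irrelevant; as \<open>I\<close> is open they do
  not influence the derivatives at points of \<open>I\<close> either.
\<close>

definition is_solution ::
    "real \<Rightarrow> ('a::euclidean_space \<Rightarrow> real) \<Rightarrow> real set \<Rightarrow> (real \<Rightarrow> 'a) \<Rightarrow> bool" where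
  "is_solution k U I q \<longleftrightarrow>
     open I \<and> is_interval I \<and> I \<noteq> {} \<and>
     (\<forall>t\<in>I. q differentiable (at t) \<and>
        (velocity q has_vector_derivative (- k *\<^sub>R velocity q t - gradient U (q t))) (at t))"

definition is_maximal_solution ::
    "real \<Rightarrow> ('a::euclidean_space \<Rightarrow> real) \<Rightarrow> real set \<Rightarrow> (real \<Rightarrow> 'a) \<Rightarrow> bool" where
  "is_maximal_solution k U I q \<longleftrightarrow>
     is_solution k U I q \<and>
     (\<forall>J p. is_solution k U J p \<and> I \<subseteq> J \<and> (\<forall>t\<in>I. p t = q t) \<longrightarrow> J = I)"

definition energy :: "('a::euclidean_space \<Rightarrow> real) \<Rightarrow> 'a \<Rightarrow> 'a \<Rightarrow> real" where
  "energy U x v = (1/2) * (norm v)\<^sup>2 + U x"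

end

theory Submission
  imports Defs
begin

text \<open>
  Along a solution the energy \<open>E\<close> satisfies $E' = -k |q'|^2$, so $E$ is nonincreasing, and
  $e^{2kt}(E - U_{inf})$ has derivative $2k e^{2kt}(U(q) - U_{inf}) \<ge> 0$, so it is
  nondecreasing. These two monotonicity statements give all the estimates, the integral of
  $|q'|^2$ being bounded by the total energy drop divided by \<open>k\<close>. They also bound the velocity,
  hence the position, on bounded time intervals, so \<open>(q, q')\<close> has a limit at any finite endpoint
  of its interval; restarting the equation from that limit contradicts maximality.
\<close>

section \<open>Continuation of bounded solutions of autonomous equations\<close>

text \<open>The mean value inequality turns a bound on the derivative into a Lipschitz constant on
  the convex set. It serves twice: to obtain a limit at a finite endpoint, and to bound the position
  once the velocity is bounded.\<close>

lemma bounded_vector_derivative_imp_uniformly_continuous: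
  fixes z :: "real \<Rightarrow> 'b::real_normed_vector"
  assumes "convex S"
    and der: "\<And>t. t \<in> S \<Longrightarrow> (z has_vector_derivative z' t) (at t)"
    and "bounded (z' ` S)"
  shows "uniformly_continuous_on S z"
proof -
  from \<open>bounded (z' ` S)\<close> obtain B where B: "B > 0" "\<forall>x\<in>z' ` S. norm x \<le> B"
    unfolding bounded_pos by blast
  have "B-lipschitz_on S z"
  proof (rule bounded_derivative_imp_lipschitz)
    show "(z has_derivative (\<lambda>x. x *\<^sub>R z' t)) (at t within S)" if "t \<in> S" for t
      using der[OF that] by (auto simp: has_vector_derivative_def intro: has_derivative_at_withinI)
    show "onorm (\<lambda>x. x *\<^sub>R z' t) \<le> B" if "t \<in> S" for t
      using B that by (intro onorm_bound) (auto simp: mult.commute[of B] intro!: mult_left_mono)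
  qed (use B \<open>convex S\<close> in auto)
  then show ?thesis by (rule lipschitz_on_uniformly_continuous)
qed

lemma picard_right_exists:
  fixes F :: "'b::euclidean_space \<Rightarrow> 'b"
  assumes lip: "L-lipschitz_on (cball z0 1) F"
  shows "\<exists>h>0. \<exists>y. y b = z0 \<and>
    (\<forall>t\<in>{b..b+h}. (y has_vector_derivative F (y t)) (at t within {b..b+h}))"
proof -
  \<comment> \<open>Precomposing with the projection onto the ball makes the field globally Lipschitz and bounded,
    so the Picard operator is defined on all bounded continuous functions; for small \<open>h\<close> its
    fixed point stays in the ball, where the modified field agrees with \<open>F\<close>.\<close>
  define P where "P = closest_point (cball z0 1)"
  define G where "G = F \<circ> P"
  have L0: "0 \<le> L" using lip by (rule lipschitz_on_nonneg)
  have P_in: "P x \<in> cball z0 1" for x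
    unfolding P_def by (rule closest_point_in_set) auto
  have P_lip: "dist (P x) (P y) \<le> dist x y" for x y
    unfolding P_def by (rule closest_point_lipschitz) auto
  have G_lip: "dist (G x) (G y) \<le> L * dist x y" for x y
  proof -
    have "dist (G x) (G y) \<le> L * dist (P x) (P y)"
      unfolding G_def o_def using lip P_in P_in by (rule lipschitz_onD)
    also have "\<dots> \<le> L * dist x y" using P_lip L0 by (rule mult_left_mono)
    finally show ?thesis .
  qed
  have "L-lipschitz_on UNIV G" using G_lip L0 by (auto simp: lipschitz_on_def)
  then have G_cont: "continuous_on UNIV G" by (rule lipschitz_on_continuous_on)
  \<comment> \<open>The projected point lies within distance 1 of \<open>z0\<close>, so the
    Lipschitz bound adds at most \<open>L\<close> to \<open>norm (F z0)\<close>.\<close>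
  define M where "M = norm (F z0) + L"
  have M0: "0 \<le> M" using L0 by (simp add: M_def)
  have G_bound: "norm (G x) \<le> M" for x
  proof -
    have "dist (F (P x)) (F z0) \<le> L * dist (P x) z0"
      using lip P_in by (rule lipschitz_onD) simp
    also have "\<dots> \<le> L * 1" using P_in[of x] L0 by (intro mult_left_mono) (auto simp: dist_commute)
    finally show ?thesis
      using norm_triangle_ineq2[of "F (P x)" "F z0"] by (simp add: G_def M_def dist_norm)
  qed
  \<comment> \<open>The length \<open>h\<close> gives the contraction factor
    \<open>L * h \<le> 1/2\<close> and keeps the integral term within radius
    \<open>M * h \<le> 1\<close>; the summand 1 keeps the denominator positive when
    \<open>L = M = 0\<close>.\<close>
  define h where "h = 1 / (2 * (L + M + 1))"
  have h0: "h > 0" using L0 M0 by (simp add: h_def)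
  have Lh: "L * h \<le> 1/2" and Mh: "M * h \<le> 1"
    using L0 M0 by (simp_all add: h_def field_simps)
  \<comment> \<open>Clamping time to \<open>{b..b+h}\<close> makes the Picard operator produce
    functions on the whole line, constant outside that interval, so that it acts on the complete
    space of bounded continuous functions.\<close>
  define c where "c t = max b (min (b + h) t)" for t
  have c_in: "c t \<in> {b..b+h}" and c_le: "c t - b \<le> h" and c_ge: "b \<le> c t" for t
    using h0 by (auto simp: c_def)
  have c_id: "c t = t" if "t \<in> {b..b+h}" for t using that by (auto simp: c_def)
  have c_cont: "continuous_on UNIV c" unfolding c_def by (intro continuous_intros)
  have Gy_cont: "continuous_on S (\<lambda>s. G (apply_bcontfun y s))" for y :: "real \<Rightarrow>\<^sub>C 'b" and S
    by (rule continuous_on_compose2[OF G_cont]) auto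
  define \<Phi> where "\<Phi> y t = z0 + integral {b..c t} (\<lambda>s. G (apply_bcontfun y s))" for y t
  have int_bound: "norm (integral {b..c t} (\<lambda>s. G (apply_bcontfun y s))) \<le> M * h" for y t
  proof -
    have "norm (integral {b..c t} (\<lambda>s. G (apply_bcontfun y s))) \<le> M * (c t - b)"
      using c_ge Gy_cont G_bound by (intro integral_bound) auto
    also have "\<dots> \<le> M * h" using c_le M0 by (rule mult_left_mono)
    finally show ?thesis .
  qed
  have \<Phi>_near: "dist z0 (\<Phi> y t) \<le> 1" for y t
    using int_bound[of t y] Mh by (simp add: \<Phi>_def dist_norm)
  have \<Phi>_bcont: "\<Phi> y \<in> bcontfun" for y
  proof (rule bcontfun_normI)
    have "continuous_on {b..b+h} (\<lambda>u. integral {b..u} (\<lambda>s. G (apply_bcontfun y s)))"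
      by (rule indefinite_integral_continuous_1[OF integrable_continuous_real[OF Gy_cont]])
    from continuous_on_compose2[OF this c_cont]
    have "continuous_on UNIV (\<lambda>t. integral {b..c t} (\<lambda>s. G (apply_bcontfun y s)))"
      by (simp add: image_subset_iff c_in del: atLeastAtMost_iff)
    then show "continuous_on UNIV (\<Phi> y)"
      unfolding \<Phi>_def by (intro continuous_on_add continuous_on_const)
    show "norm (\<Phi> y t) \<le> norm z0 + 1" for t
      using \<Phi>_near[of y t] norm_triangle_ineq2[of "\<Phi> y t" z0]
      unfolding dist_norm norm_minus_commute[of z0] by linarith
  qed
  define \<Psi> where "\<Psi> y = Bcontfun (\<Phi> y)" for y
  have \<Psi>: "apply_bcontfun (\<Psi> y) = \<Phi> y" for y
    unfolding \<Psi>_def using \<Phi>_bcont by (rule Bcontfun_inverse)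
  have "dist (\<Psi> x) (\<Psi> y) \<le> 1/2 * dist x y" for x y
  proof (rule dist_bound)
    fix t
    have "dist (\<Phi> x t) (\<Phi> y t)
      = norm (integral {b..c t} (\<lambda>s. G (apply_bcontfun x s) - G (apply_bcontfun y s)))"
      unfolding \<Phi>_def dist_norm
      by (subst integral_diff) (auto intro!: integrable_continuous_real Gy_cont)
    also have "\<dots> \<le> (L * dist x y) * (c t - b)"
    proof (rule integral_bound)
      fix s
      have "norm (G (apply_bcontfun x s) - G (apply_bcontfun y s)) \<le> L * dist (x s) (y s)"
        using G_lip by (simp add: dist_norm)
      also have "\<dots> \<le> L * dist x y" using dist_bounded L0 by (rule mult_left_mono)
      finally show "norm (G (apply_bcontfun x s) - G (apply_bcontfun y s)) \<le> L * dist x y" .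
    qed (rule c_ge, intro continuous_on_diff Gy_cont)
    also have "\<dots> \<le> (L * dist x y) * h" using c_le L0 by (intro mult_left_mono) auto
    also have "\<dots> \<le> 1/2 * dist x y" using mult_right_mono[OF Lh, of "dist x y"] by (simp add: ac_simps)
    finally show "dist (\<Psi> x t) (\<Psi> y t) \<le> 1/2 * dist x y" by (simp add: \<Psi>)
  qed
  then obtain y where "\<Psi> y = y"
    using banach_fix_type[of "1/2" \<Psi>] by auto
  then have y: "apply_bcontfun y t = \<Phi> y t" for t using \<Psi> by metis
  have y_eq: "y t = z0 + integral {b..t} (\<lambda>s. G (apply_bcontfun y s))" if "t \<in> {b..b+h}" for t
    unfolding y[of t] \<Phi>_def c_id[OF that] ..
  have P_id: "G (y t) = F (y t)" for t
    using \<Phi>_near[of y t] by (simp add: G_def P_def y closest_point_self)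
  have "(y has_vector_derivative F (y t)) (at t within {b..b+h})" if t: "t \<in> {b..b+h}" for t
  proof -
    have "((\<lambda>u. z0 + integral {b..u} (\<lambda>s. G (apply_bcontfun y s))) has_vector_derivative G (y t))
        (at t within {b..b+h})"
      using integral_has_vector_derivative[OF Gy_cont t, of y]
      by (auto intro!: derivative_eq_intros)
    then show ?thesis
      unfolding P_id using t
      by (rule has_vector_derivative_transform[rotated 2]) (rule y_eq[unfolded P_id])
  qed
  moreover have "y b = z0" using h0 y_eq[of b] by simp
  ultimately show ?thesis using h0 by blast
qed

text \<open>A bounded trajectory stays in a compact ball, where \<open>F\<close> is bounded. Hence
  \<open>z\<close> is uniformly continuous up to \<open>b\<close> and has a limit there, from which
  the local Picard solution restarts.\<close>

lemma autonomous_extend_right: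
  fixes F :: "'b::euclidean_space \<Rightarrow> 'b"
  assumes lip: "\<And>x r. \<exists>L. L-lipschitz_on (cball x r) F"
    and der: "\<And>t. t \<in> I \<Longrightarrow> (z has_vector_derivative F (z t)) (at t)"
    and "open I" "I \<subseteq> {..<b}" "{c..<b} \<subseteq> I" "c < b"
    and bdd: "bounded (z ` {c..<b})"
  shows "\<exists>h>0. \<exists>w. (\<forall>t\<in>I. w t = z t) \<and>
    (\<forall>t\<in>I \<union> {b..<b+h}. (w has_vector_derivative F (w t)) (at t))"
proof -
  from bdd obtain r where "z ` {c..<b} \<subseteq> cball 0 r"
    by (auto simp: bounded_iff subset_iff)
  then have r: "z t \<in> cball 0 r" if "t \<in> {c..<b}" for t using that by blast
  have F_cont: "continuous_on UNIV F"
  proof -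
    have "isCont F x" for x
    proof -
      from lip[of x 1] obtain K where "K-lipschitz_on (cball x 1) F" by blast
      then have "continuous_on (cball x 1) F" by (rule lipschitz_on_continuous_on)
      then show ?thesis by (rule continuous_on_interior) simp
    qed
    then show ?thesis by (simp add: continuous_on_eq_continuous_at)
  qed
  have "bounded ((\<lambda>t. F (z t)) ` {c..<b})"
  proof (rule bounded_subset)
    show "bounded (F ` cball 0 r)"
      by (intro compact_imp_bounded compact_continuous_image continuous_on_subset[OF F_cont]) auto
  qed (use r in blast)
  with der \<open>{c..<b} \<subseteq> I\<close> have "uniformly_continuous_on {c..<b} z"
    by (intro bounded_vector_derivative_imp_uniformly_continuous) auto
  moreover have "b \<in> closure {c..<b}" using \<open>c < b\<close> by simp
  ultimately obtain l where l: "(z \<longlongrightarrow> l) (at b within {c..<b})"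
    by (rule uniformly_continuous_on_extension_at_closure)
  from lip[of l 1] obtain K where "K-lipschitz_on (cball l 1) F" by blast
  from picard_right_exists[OF this, of b] obtain h y where h: "h > 0" and yb: "y b = l"
    and y: "\<And>t. t \<in> {b..b+h} \<Longrightarrow> (y has_vector_derivative F (y t)) (at t within {b..b+h})"
    by blast
  \<comment> \<open>Gluing at the limit point \<open>b\<close> itself makes the extension agree with \<open>z\<close> on \<open>I\<close> without
    any uniqueness theorem; the integral equation then gives the derivative at \<open>b\<close>.\<close>
  define w where "w t = (if t < b then z t else y t)" for t
  have wI: "w t = z t" if "t \<in> I" for t using that \<open>I \<subseteq> {..<b}\<close> by (auto simp: w_def)
  have w_left: "(w has_vector_derivative F (w t)) (at t)" if "t \<in> I" for t
    using has_vector_derivative_transform_within_open[OF der[OF that] \<open>open I\<close> that] wI that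
    by metis
  have w_right: "(w has_vector_derivative F (w t)) (at t)" if "t \<in> {b<..<b+h}" for t
  proof -
    have "(y has_vector_derivative F (y t)) (at t)"
      using y[of t] that by (simp add: at_within_Icc_at)
    then have "(w has_vector_derivative F (y t)) (at t)"
      by (rule has_vector_derivative_transform_within_open[of _ _ _ "{b<..<b+h}"])
         (use that in \<open>auto simp: w_def\<close>)
    then show ?thesis using that by (simp add: w_def)
  qed
  have w_der: "(w has_vector_derivative F (w t)) (at t)" if "t \<in> {c<..<b+h} - {b}" for t
  proof (cases "t < b")
    case True
    then have "t \<in> I" using that \<open>{c..<b} \<subseteq> I\<close> by auto
    then show ?thesis by (rule w_left)
  qed (use that w_right in auto)
  have w_cont: "continuous_on {c..b+h} w"
  proof -
    have "continuous_on {c..b} w"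
      unfolding continuous_on_def
    proof
      fix t assume t: "t \<in> {c..b}"
      show "(w \<longlongrightarrow> w t) (at t within {c..b})"
      proof (cases "t = b")
        case True
        \<comment> \<open>The filter at \<open>b\<close> ignores \<open>b\<close> itself, so the
          limit of \<open>z\<close> from the left is also the limit of \<open>w\<close>, and it
          equals the value \<open>w b = y b = l\<close>.\<close>
        have "{c..b} - {b} = {c..<b}" by auto
        then have "at b within {c..b} = at b within {c..<b}"
          by (metis at_within_def Diff_idemp)
        moreover have "(w \<longlongrightarrow> l) (at b within {c..<b})"
          using l by (rule Lim_transform_eventually) (auto simp: eventually_at_filter w_def)
        ultimately show ?thesis using True yb by (simp add: w_def)
      next
        case False
        then have "t \<in> I" using t \<open>{c..<b} \<subseteq> I\<close> by auto
        then have "isCont w t" using w_left has_vector_derivative_continuous by blast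
        then show ?thesis by (simp add: continuous_at_imp_continuous_at_within continuous_within[symmetric])
      qed
    qed
    moreover have "continuous_on {b..b+h} w"
    proof -
      have "continuous_on {b..b+h} y"
        using y by (rule continuous_on_vector_derivative)
      then show ?thesis by (rule continuous_on_eq) (auto simp: w_def)
    qed
    moreover have "{c..b+h} = {c..b} \<union> {b..b+h}" using h \<open>c < b\<close> by auto
    ultimately show ?thesis by (simp add: continuous_on_closed_Un)
  qed
  \<comment> \<open>Differentiability at \<open>b\<close> is not known yet; this version of the
    fundamental theorem admits \<open>b\<close> as an exceptional point because \<open>w\<close> is
    continuous there.\<close>
  have int: "w c + integral {c..t} (F \<circ> w) = w t" if t: "t \<in> {c..b+h}" for t
  proof -
    have "((F \<circ> w) has_integral (w t - w c)) {c..t}"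
    proof (rule fundamental_theorem_of_calculus_interior_strong[of "{b}"])
      show "continuous_on {c..t} w" using w_cont by (rule continuous_on_subset) (use t in auto)
      show "(w has_vector_derivative (F \<circ> w) x) (at x)" if "x \<in> {c<..<t} - {b}" for x
        using w_der[of x] that t by auto
    qed (use t in auto)
    then show ?thesis by (simp add: integral_unique)
  qed
  \<comment> \<open>The integrand \<open>F \<circ> w\<close> is continuous across \<open>b\<close>,
    so the integral can be differentiated there; as \<open>b\<close> is interior to
    \<open>{c..b+h}\<close>, the derivative is two-sided.\<close>
  have "(w has_vector_derivative F (w b)) (at b)"
  proof -
    have bin: "b \<in> {c..b+h}" using h \<open>c < b\<close> by auto
    have "continuous_on {c..b+h} (F \<circ> w)"
      using w_cont continuous_on_subset[OF F_cont] by (intro continuous_on_compose) auto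
    from integral_has_vector_derivative[OF this bin]
    have "((\<lambda>t. w c + integral {c..t} (F \<circ> w)) has_vector_derivative F (w b)) (at b within {c..b+h})"
      by (auto intro!: derivative_eq_intros)
    then have "(w has_vector_derivative F (w b)) (at b within {c..b+h})"
      by (rule has_vector_derivative_transform[rotated 2]) (use bin int in auto)
    then show ?thesis using h \<open>c < b\<close> by (simp add: at_within_Icc_at)
  qed
  then have "\<forall>t\<in>I \<union> {b..<b+h}. (w has_vector_derivative F (w t)) (at t)"
    using w_left w_right by (metis UnE atLeastLessThan_iff greaterThanLessThan_iff order_le_less)
  then show ?thesis using h wI by blast
qed

text \<open>Time reversal turns an integral curve of \<open>F\<close> into one of \<open>- F\<close>
  and a left endpoint into a right one. Reversing the extended curve again restores the
  sign.\<close>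

lemma autonomous_extend_left:
  fixes F :: "'b::euclidean_space \<Rightarrow> 'b"
  assumes lip: "\<And>x r. \<exists>L. L-lipschitz_on (cball x r) F"
    and der: "\<And>t. t \<in> I \<Longrightarrow> (z has_vector_derivative F (z t)) (at t)"
    and "open I" "I \<subseteq> {a<..}" "{a<..c} \<subseteq> I" "a < c"
    and bdd: "bounded (z ` {a<..c})"
  shows "\<exists>h>0. \<exists>w. (\<forall>t\<in>I. w t = z t) \<and>
    (\<forall>t\<in>I \<union> {a-h<..a}. (w has_vector_derivative F (w t)) (at t))"
proof -
  have rev: "((\<lambda>t. g (- t)) has_vector_derivative - d) (at t)"
    if "(g has_vector_derivative d) (at (- t))" for g :: "real \<Rightarrow> 'b" and d t
  proof -
    have "(uminus has_vector_derivative -1) (at t)"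
      by (auto intro!: derivative_eq_intros)
    from vector_diff_chain_at[OF this that] show ?thesis by (simp add: o_def)
  qed
  have "\<exists>h>0. \<exists>w. (\<forall>t\<in>uminus ` I. w t = z (- t)) \<and>
    (\<forall>t\<in>uminus ` I \<union> {-a..<-a+h}. (w has_vector_derivative - F (w t)) (at t))"
  proof (rule autonomous_extend_right)
    show "\<exists>L. L-lipschitz_on (cball x r) (\<lambda>x. - F x)" for x r using lip by simp
    show "((\<lambda>t. z (- t)) has_vector_derivative - F (z (- t))) (at t)" if "t \<in> uminus ` I" for t
      by (rule rev) (use der that in auto)
    show "open (uminus ` I)" using \<open>open I\<close> by (rule open_negations)
    show "uminus ` I \<subseteq> {..<-a}" using \<open>I \<subseteq> {a<..}\<close> by auto
    show "{-c..<-a} \<subseteq> uminus ` I"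
    proof
      fix t assume "t \<in> {-c..<-a}"
      then have "- t \<in> I" using \<open>{a<..c} \<subseteq> I\<close> by auto
      then show "t \<in> uminus ` I" by (metis image_eqI minus_minus)
    qed
    show "-c < -a" using \<open>a < c\<close> by simp
    show "bounded ((\<lambda>t. z (- t)) ` {-c..<-a})"
      using bdd by (rule bounded_subset) auto
  qed
  then obtain h w where h: "h > 0" and w: "\<forall>t\<in>uminus ` I. w t = z (- t)"
    and wd: "\<forall>t\<in>uminus ` I \<union> {-a..<-a+h}. (w has_vector_derivative - F (w t)) (at t)"
    by blast
  have "((\<lambda>t. w (- t)) has_vector_derivative F (w (- t))) (at t)" if "t \<in> I \<union> {a-h<..a}" for t
    using rev[OF bspec[OF wd, of "- t"]] that by auto
  then show ?thesis using h w by (intro exI[of _ h] conjI exI[of _ "\<lambda>t. w (- t)"]) auto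
qed

section \<open>The gradient of a smooth potential\<close>

text \<open>On the compact ball each directional derivative is bounded. Expanding a vector in the
  basis bounds the operator norm of the derivative by the sum of the basis bounds, and convexity of
  the ball yields the Lipschitz estimate.\<close>

lemma ck1_imp_lipschitz_on_cball:
  fixes f :: "'a::euclidean_space \<Rightarrow> real"
  assumes "ck 1 f"
  shows "\<exists>L. L-lipschitz_on (cball x r) f"
proof -
  let ?D = "\<lambda>y. frechet_derivative f (at y)"
  have diff: "(f has_derivative ?D y) (at y)" for y
    using assms by (simp add: frechet_derivative_works)
  have cont: "continuous_on UNIV (\<lambda>y. ?D y v)" for v using assms by simp
  have "\<exists>B\<ge>0. \<forall>y\<in>cball x r. norm (?D y v) \<le> B" for v
  proof -
    have "bounded ((\<lambda>y. ?D y v) ` cball x r)"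
      by (intro compact_imp_bounded compact_continuous_image continuous_on_subset[OF cont]) auto
    then show ?thesis unfolding bounded_pos by (metis image_eqI less_imp_le)
  qed
  then obtain B where B0: "\<And>v. 0 \<le> B v"
    and B: "\<And>v y. y \<in> cball x r \<Longrightarrow> norm (?D y v) \<le> B v" by metis
  have "(\<Sum>b\<in>Basis. B b)-lipschitz_on (cball x r) f"
  proof (rule bounded_derivative_imp_lipschitz)
    show "(f has_derivative ?D y) (at y within cball x r)" for y
      using diff by (rule has_derivative_at_withinI)
    show "onorm (?D y) \<le> (\<Sum>b\<in>Basis. B b)" if "y \<in> cball x r" for y
    proof (rule onorm_bound)
      fix v
      interpret D: bounded_linear "?D y" using diff by (rule has_derivative_bounded_linear)
      have "?D y v = ?D y (\<Sum>b\<in>Basis. (v \<bullet> b) *\<^sub>R b)" by (simp add: euclidean_representation)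
      also have "\<dots> = (\<Sum>b\<in>Basis. (v \<bullet> b) * ?D y b)" by (simp add: D.sum D.scaleR)
      finally have "norm (?D y v) \<le> (\<Sum>b\<in>Basis. \<bar>v \<bullet> b\<bar> * \<bar>?D y b\<bar>)"
        using norm_sum[of "\<lambda>b. (v \<bullet> b) * ?D y b" Basis] by (simp add: abs_mult)
      also have "\<dots> \<le> (\<Sum>b\<in>Basis. norm v * B b)"
        using B[OF that] Basis_le_norm by (intro sum_mono mult_mono) auto
      finally show "norm (?D y v) \<le> (\<Sum>b\<in>Basis. B b) * norm v"
        by (simp add: sum_distrib_left mult.commute)
    qed (simp add: B0 sum_nonneg)
  qed (simp_all add: B0 sum_nonneg)
  then show ?thesis by blast
qed

lemma GDERIV_unique:
  assumes "GDERIV f x :> D" "GDERIV f x :> D'"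
  shows "D = D'"
proof -
  have "(\<lambda>h. h \<bullet> D) = (\<lambda>h. h \<bullet> D')"
    using assms unfolding gderiv_def by (rule has_derivative_unique)
  then have "\<forall>h. h \<bullet> D = h \<bullet> D'" by metis
  then show ?thesis by (simp add: vector_eq_ldot)
qed

text \<open>The vector whose coordinates are the partial derivatives represents the Frechet
  derivative by the inner product. Uniqueness of such a vector makes the \<open>THE\<close> in
  \<open>gradient\<close> well defined.\<close>

lemma
  fixes U :: "'a::euclidean_space \<Rightarrow> real"
  assumes "U differentiable (at x)"
  shows GDERIV_gradient: "GDERIV U x :> gradient U x"
    and inner_gradient: "gradient U x \<bullet> v = frechet_derivative U (at x) v"
proof -
  let ?f = "frechet_derivative U (at x)"
  have der: "(U has_derivative ?f) (at x)"
    using assms by (simp add: frechet_derivative_works)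
  interpret f: bounded_linear ?f using der by (rule has_derivative_bounded_linear)
  have "h \<bullet> (\<Sum>b\<in>Basis. ?f b *\<^sub>R b) = ?f (\<Sum>b\<in>Basis. (h \<bullet> b) *\<^sub>R b)" for h
    by (simp add: inner_sum_right f.sum f.scaleR mult.commute)
  then have "h \<bullet> (\<Sum>b\<in>Basis. ?f b *\<^sub>R b) = ?f h" for h by (simp add: euclidean_representation)
  then have D: "GDERIV U x :> (\<Sum>b\<in>Basis. ?f b *\<^sub>R b)"
    using der by (simp add: gderiv_def)
  show *: "GDERIV U x :> gradient U x"
    unfolding gradient_def by (rule theI, rule D) (rule GDERIV_unique[OF _ D])
  have "(\<lambda>h. h \<bullet> gradient U x) = ?f"
    using * der unfolding gderiv_def by (rule has_derivative_unique)
  then show "gradient U x \<bullet> v = ?f v" by (metis inner_commute)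
qed

text \<open>Each component of the gradient is a directional derivative of \<open>U\<close>, hence of
  class C^1 and Lipschitz on balls; bounding the norm by the sum of absolute coordinates adds the
  constants.\<close>

lemma smooth_imp_gradient_lipschitz_on_cball:
  assumes "smooth U"
  shows "\<exists>L. L-lipschitz_on (cball x r) (gradient U)"
proof -
  have "ck 2 U" using assms by (simp add: smooth_def)
  then have diff: "\<And>y. U differentiable (at y)"
    and ck1: "\<And>v. ck 1 (\<lambda>y. frechet_derivative U (at y) v)"
    by (simp_all add: numeral_2_eq_2)
  from ck1_imp_lipschitz_on_cball[OF ck1]
  obtain L where L: "\<And>v. (L v)-lipschitz_on (cball x r) (\<lambda>y. gradient U y \<bullet> v)"
    unfolding inner_gradient[OF diff] by metis
  have "(\<Sum>b\<in>Basis. L b)-lipschitz_on (cball x r) (gradient U)"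
  proof (rule lipschitz_onI)
    fix y z assume yz: "y \<in> cball x r" "z \<in> cball x r"
    have "dist (gradient U y) (gradient U z) \<le> (\<Sum>b\<in>Basis. \<bar>(gradient U y - gradient U z) \<bullet> b\<bar>)"
      unfolding dist_norm by (rule norm_le_l1)
    also have "\<dots> \<le> (\<Sum>b\<in>Basis. L b * dist y z)"
      using lipschitz_onD[OF L yz] by (intro sum_mono) (simp add: dist_norm inner_diff_left)
    finally show "dist (gradient U y) (gradient U z) \<le> (\<Sum>b\<in>Basis. L b) * dist y z"
      by (simp add: sum_distrib_right)
  qed (use lipschitz_on_nonneg[OF L] in \<open>simp add: sum_nonneg\<close>)
  then show ?thesis by blast
qed

section \<open>Energy estimates and continuation of solutions\<close>

text \<open>Rewriting the second-order equation as an autonomous first-order system for position and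
  velocity makes the continuation lemmas applicable.\<close>

definition phase_field :: "real \<Rightarrow> ('a::euclidean_space \<Rightarrow> real) \<Rightarrow> 'a \<times> 'a \<Rightarrow> 'a \<times> 'a" where
  "phase_field k U z = (snd z, - k *\<^sub>R snd z - gradient U (fst z))"

lemma phase_field_lipschitz_on_cball:
  assumes "smooth U"
  shows "\<exists>L. L-lipschitz_on (cball z r) (phase_field k U)"
proof -
  obtain K where K: "K-lipschitz_on (cball (fst z) r) (gradient U)"
    using smooth_imp_gradient_lipschitz_on_cball[OF assms] by blast
  have K0: "0 \<le> K" using K by (rule lipschitz_on_nonneg)
  \<comment> \<open>The 1 accounts for the position component, \<open>\<bar>k\<bar>\<close> for the
    damping and \<open>K\<close> for the gradient. Projection to the position does not increase
    distances, so the ball in phase space maps into the ball on which \<open>K\<close> is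
    valid.\<close>
  have "(1 + (\<bar>k\<bar> + K))-lipschitz_on (cball z r) (phase_field k U)"
  proof (rule lipschitz_onI)
    fix x y assume "x \<in> cball z r" "y \<in> cball z r"
    then have "fst x \<in> cball (fst z) r" "fst y \<in> cball (fst z) r"
      using order_trans[OF dist_fst_le] unfolding mem_cball by blast+
    then have "dist (gradient U (fst x)) (gradient U (fst y)) \<le> K * dist (fst x) (fst y)"
      by (rule lipschitz_onD[OF K])
    also have "\<dots> \<le> K * dist x y" using dist_fst_le K0 by (rule mult_left_mono)
    finally have grad: "norm (gradient U (fst x) - gradient U (fst y)) \<le> K * dist x y"
      unfolding dist_norm[of "gradient U (fst x)"] .
    have vel: "norm (snd x - snd y) \<le> dist x y" 
      unfolding dist_norm[of "snd x" "snd y", symmetric] by (rule dist_snd_le)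
    have eq: "phase_field k U x - phase_field k U y
        = (snd x - snd y, - k *\<^sub>R (snd x - snd y) - (gradient U (fst x) - gradient U (fst y)))"
      by (simp add: phase_field_def algebra_simps)
    have "norm (- k *\<^sub>R (snd x - snd y) - (gradient U (fst x) - gradient U (fst y)))
        \<le> \<bar>k\<bar> * norm (snd x - snd y) + norm (gradient U (fst x) - gradient U (fst y))"
      by (rule order_trans[OF norm_triangle_ineq4]) simp
    also have "\<dots> \<le> \<bar>k\<bar> * dist x y + K * dist x y"
      using vel grad by (intro add_mono mult_left_mono) auto
    finally have "norm (phase_field k U x - phase_field k U y) \<le> dist x y + (\<bar>k\<bar> * dist x y + K * dist x y)"
      unfolding eq by (rule order_trans[OF norm_Pair_le add_mono[OF vel]])
    then show "dist (phase_field k U x) (phase_field k U y) \<le> (1 + (\<bar>k\<bar> + K)) * dist x y"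
      by (simp add: dist_norm[of "phase_field k U x"] algebra_simps)
  qed (use K0 in simp)
  then show ?thesis by blast
qed

text \<open>This leads back from the first-order system to the original equation. The velocity of
  the first component equals the second component only on \<open>J\<close>; openness of
  \<open>J\<close> lets derivatives transfer between the two.\<close>

lemma is_solution_fst:
  assumes "open J" "is_interval J" "J \<noteq> {}"
    and der: "\<And>t. t \<in> J \<Longrightarrow> (w has_vector_derivative phase_field k U (w t)) (at t)"
  shows "is_solution k U J (fst \<circ> w)"
proof -
  have p: "((fst \<circ> w) has_vector_derivative snd (w t)) (at t)" if "t \<in> J" for t
    using bounded_linear.has_vector_derivative[OF bounded_linear_fst der[OF that]]
    by (simp add: phase_field_def o_def)
  then have vel: "velocity (fst \<circ> w) t = snd (w t)" if "t \<in> J" for t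
    unfolding velocity_def using that by (blast intro: vector_derivative_at)
  have "(velocity (fst \<circ> w) has_vector_derivative
      - k *\<^sub>R velocity (fst \<circ> w) t - gradient U ((fst \<circ> w) t)) (at t)" if "t \<in> J" for t
  proof -
    have "((\<lambda>t. snd (w t)) has_vector_derivative - k *\<^sub>R snd (w t) - gradient U (fst (w t))) (at t)"
      using bounded_linear.has_vector_derivative[OF bounded_linear_snd der[OF that]]
      by (simp add: phase_field_def)
    then have "(velocity (fst \<circ> w) has_vector_derivative - k *\<^sub>R snd (w t) - gradient U (fst (w t))) (at t)"
      by (rule has_vector_derivative_transform_within_open[OF _ \<open>open J\<close> that]) (simp add: vel)
    then show ?thesis using vel[OF that] by simp
  qed
  then show ?thesis
    unfolding is_solution_def using assms p differentiableI_vector by blast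
qed

section \<open>Energy balance along a fixed solution\<close>

context
  fixes k :: real and U :: "'a::euclidean_space \<Rightarrow> real" and I :: "real set" and q :: "real \<Rightarrow> 'a"
  assumes k: "k > 0" and smooth: "smooth U" and sol: "is_solution k U I q"
begin

lemma position_derivative: "t \<in> I \<Longrightarrow> (q has_vector_derivative velocity q t) (at t)"
  using sol unfolding is_solution_def velocity_def by (auto simp: vector_derivative_works)

lemma velocity_derivative:
  "t \<in> I \<Longrightarrow> (velocity q has_vector_derivative - k *\<^sub>R velocity q t - gradient U (q t)) (at t)"
  using sol unfolding is_solution_def by blast

lemma phase_derivative:
  "t \<in> I \<Longrightarrow> ((\<lambda>t. (q t, velocity q t)) has_vector_derivative phase_field k U (q t, velocity q t)) (at t)"
  unfolding phase_field_def fst_conv snd_conv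
  by (intro has_vector_derivative_Pair position_derivative velocity_derivative)

lemma mem_interval: "a \<in> I \<Longrightarrow> b \<in> I \<Longrightarrow> a \<le> t \<Longrightarrow> t \<le> b \<Longrightarrow> t \<in> I"
  using sol unfolding is_solution_def is_interval_1 by blast

text \<open>The kinetic part contributes the inner product of velocity and acceleration, the
  potential part that of velocity and gradient. The gradient terms cancel and only the damping
  remains.\<close>

lemma energy_derivative:
  assumes "t \<in> I"
  shows "((\<lambda>t. energy U (q t) (velocity q t)) has_real_derivative - k * (norm (velocity q t))\<^sup>2) (at t)"
proof -
  have "ck 1 U" using smooth by (simp add: smooth_def)
  then have "U differentiable (at (q t))" by simp
  then have "(U has_derivative (\<lambda>h. h \<bullet> gradient U (q t))) (at (q t))"
    using GDERIV_gradient unfolding gderiv_def by blast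
  from has_derivative_compose[OF position_derivative[OF assms, unfolded has_vector_derivative_def] this]
  have "((\<lambda>t. U (q t)) has_real_derivative velocity q t \<bullet> gradient U (q t)) (at t)"
    by (simp add: has_field_derivative_def mult.commute[of _ "velocity q t \<bullet> gradient U (q t)"]) 
  moreover have "((\<lambda>t. velocity q t \<bullet> velocity q t) has_real_derivative
      2 * (velocity q t \<bullet> (- k *\<^sub>R velocity q t - gradient U (q t)))) (at t)"
    using has_derivative_inner[OF velocity_derivative[OF assms, unfolded has_vector_derivative_def]
        velocity_derivative[OF assms, unfolded has_vector_derivative_def]]
    by (rule has_derivative_imp_has_field_derivative) (simp add: inner_commute algebra_simps)
  ultimately have "((\<lambda>t. (1/2) * (velocity q t \<bullet> velocity q t) + U (q t)) has_real_derivative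
      (1/2) * (2 * (velocity q t \<bullet> (- k *\<^sub>R velocity q t - gradient U (q t))))
        + velocity q t \<bullet> gradient U (q t)) (at t)"
    by (intro DERIV_add DERIV_cmult)
  then show ?thesis
    unfolding energy_def power2_norm_eq_inner by (simp add: inner_diff_right diff_divide_distrib)
qed

lemma energy_nonincreasing:
  assumes "a \<in> I" "b \<in> I" "a \<le> b"
  shows "energy U (q b) (velocity q b) \<le> energy U (q a) (velocity q a)"
proof (rule DERIV_nonpos_imp_nonincreasing[OF \<open>a \<le> b\<close>])
  show "\<exists>y. ((\<lambda>t. energy U (q t) (velocity q t)) has_real_derivative y) (at t) \<and> y \<le> 0"
    if "a \<le> t" "t \<le> b" for t
    using energy_derivative[OF mem_interval[OF assms(1,2) that]] k
    by (intro exI conjI) auto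
qed

lemma energy_past:
  assumes m: "\<And>x. m \<le> U x" and "a \<in> I" "b \<in> I" "a \<le> b"
  shows "energy U (q a) (velocity q a) - m
    \<le> exp (2 * k * (b - a)) * (energy U (q b) (velocity q b) - m)"
proof -
  let ?E = "\<lambda>t. energy U (q t) (velocity q t)"
  have "exp (2 * k * a) * (?E a - m) \<le> exp (2 * k * b) * (?E b - m)"
  proof (rule DERIV_nonneg_imp_nondecreasing[OF \<open>a \<le> b\<close>])
    fix t assume "a \<le> t" "t \<le> b"
    then have t: "t \<in> I" using mem_interval assms by blast
    \<comment> \<open>The rate \<open>2 * k\<close> is chosen so that the kinetic part of
      \<open>2 * k * ?E t\<close> cancels the dissipation
      \<open>- k * (norm (velocity q t))\<^sup>2\<close>.\<close>
    have "((\<lambda>t. exp (2 * k * t) * (?E t - m)) has_real_derivative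
        exp (2 * k * t) * (2 * k * (U (q t) - m))) (at t)"
      by (rule derivative_eq_intros energy_derivative[OF t] refl | simp)+
         (simp add: energy_def algebra_simps)
    moreover have "exp (2 * k * t) * (2 * k * (U (q t) - m)) \<ge> 0" using k m by simp
    ultimately show "\<exists>y. ((\<lambda>t. exp (2 * k * t) * (?E t - m)) has_real_derivative y) (at t) \<and> 0 \<le> y"
      by blast
  qed
  then have "exp (- (2 * k * a)) * (exp (2 * k * a) * (?E a - m))
      \<le> exp (- (2 * k * a)) * (exp (2 * k * b) * (?E b - m))"
    by (rule mult_left_mono) simp
  moreover have "exp (- x) * (exp x * y) = y" for x y :: real by (simp add: exp_minus)
  moreover have "exp (2 * k * (b - a)) = exp (- (2 * k * a)) * exp (2 * k * b)"
    by (simp add: exp_add[symmetric] algebra_simps)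
  ultimately show ?thesis by (simp only: mult.assoc)
qed

section \<open>A priori bounds and continuation past a finite endpoint\<close>

lemma phase_bounded:
  assumes "convex S" "bounded S" "S \<subseteq> I" and V: "\<And>t. t \<in> S \<Longrightarrow> (norm (velocity q t))\<^sup>2 \<le> V"
  shows "bounded ((\<lambda>t. (q t, velocity q t)) ` S)"
proof -
  have "norm (velocity q t) \<le> sqrt V" if "t \<in> S" for t
    using V[OF that] by (rule real_le_rsqrt)
  then have v: "bounded (velocity q ` S)" unfolding bounded_iff by blast
  \<comment> \<open>The velocity is the derivative of \<open>q\<close>, so its bound controls the
    variation of \<open>q\<close> over the bounded time set \<open>S\<close>.\<close>
  have "uniformly_continuous_on S q"
    using \<open>convex S\<close> _ v
    by (rule bounded_vector_derivative_imp_uniformly_continuous)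
       (use position_derivative \<open>S \<subseteq> I\<close> in blast)
  then have "bounded (q ` S)" using \<open>bounded S\<close> by (rule bounded_uniformly_continuous_image)
  then have "bounded (q ` S \<times> velocity q ` S)" using v by (rule bounded_Times)
  then show ?thesis by (rule bounded_subset) auto
qed

text \<open>Forward in time the energy does not exceed its value at \<open>c\<close>, and since
  \<open>U\<close> is bounded below this bounds the velocity up to the supremum of \<open>I\<close>.
  The conclusion is the negation of maximality.\<close>

lemma solution_extends_right:
  assumes m: "\<And>x. m \<le> U x" and "c \<in> I" "bdd_above I"
  shows "\<exists>J p. is_solution k U J p \<and> I \<subseteq> J \<and> (\<forall>t\<in>I. p t = q t) \<and> J \<noteq> I"
proof -
  define b where "b = Sup I"
  have "open I" "is_interval I" using sol by (auto simp: is_solution_def)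
  \<comment> \<open>An open set does not contain its supremum.\<close>
  have less: "t < b" if t: "t \<in> I" for t
  proof -
    from \<open>open I\<close> t obtain e where "e > 0" "cball t e \<subseteq> I" by (meson open_contains_cball)
    then have "t + e \<in> I" by (auto simp: subset_iff dist_real_def)
    then have "t + e \<le> b" unfolding b_def using \<open>bdd_above I\<close> by (rule cSup_upper)
    then show ?thesis using \<open>e > 0\<close> by simp
  qed
  have sub: "{c..<b} \<subseteq> I"
  proof
    fix t assume "t \<in> {c..<b}"
    then obtain s where "s \<in> I" "t < s"
      using less_cSup_iff[OF _ \<open>bdd_above I\<close>, of t] \<open>c \<in> I\<close> unfolding b_def by auto
    then show "t \<in> I" using mem_interval[OF \<open>c \<in> I\<close>] \<open>t \<in> {c..<b}\<close> by auto
  qed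
  have bdd: "bounded ((\<lambda>t. (q t, velocity q t)) ` {c..<b})"
  proof (rule phase_bounded[OF _ _ sub])
    fix t assume "t \<in> {c..<b}"
    then have "energy U (q t) (velocity q t) \<le> energy U (q c) (velocity q c)"
      using energy_nonincreasing[OF \<open>c \<in> I\<close>] sub by auto
    then show "(norm (velocity q t))\<^sup>2 \<le> 2 * (energy U (q c) (velocity q c) - m)"
      using m[of "q t"] by (simp add: energy_def[of U "q t"])
  qed auto
  from autonomous_extend_right[OF phase_field_lipschitz_on_cball[OF smooth] phase_derivative
      \<open>open I\<close> _ sub less[OF \<open>c \<in> I\<close>] bdd] less
  obtain h w where h: "h > 0" and w: "\<forall>t\<in>I. w t = (q t, velocity q t)"
    and wd: "\<forall>t\<in>I \<union> {b..<b+h}. (w has_vector_derivative phase_field k U (w t)) (at t)"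
    by blast
  define J where "J = I \<union> {b..<b+h}"
  \<comment> \<open>Two descriptions of \<open>J\<close>: as a union of open sets, which shows
    openness, and as a union of connected sets sharing the point \<open>c\<close>, which shows that
    it is an interval.\<close>
  have J1: "J = I \<union> {c<..<b+h}" and J2: "J = I \<union> {c..<b+h}"
    using sub less[OF \<open>c \<in> I\<close>] \<open>c \<in> I\<close> unfolding J_def by (auto simp: subset_iff)
  have "open J" unfolding J1 using \<open>open I\<close> by (simp add: open_Un)
  moreover have "is_interval J"
    unfolding is_interval_connected_1 J2
    using \<open>is_interval I\<close> \<open>c \<in> I\<close> less[OF \<open>c \<in> I\<close>] h
    by (intro connected_Un) (auto simp: is_interval_connected_1)
  ultimately have "is_solution k U J (fst \<circ> w)"
    using wd \<open>c \<in> I\<close> by (intro is_solution_fst) (auto simp: J_def)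
  moreover have "b \<in> J" "b \<notin> I" using h less by (auto simp: J_def)
  moreover have "I \<subseteq> J" by (simp add: J_def)
  ultimately show ?thesis using w by (intro exI[of _ J] exI[of _ "fst \<circ> w"]) auto
qed

text \<open>Backward in time the energy may grow, but at most exponentially, so it stays bounded
  when the left endpoint is finite.\<close>

lemma solution_extends_left:
  assumes m: "\<And>x. m \<le> U x" and "c \<in> I" "bdd_below I"
  shows "\<exists>J p. is_solution k U J p \<and> I \<subseteq> J \<and> (\<forall>t\<in>I. p t = q t) \<and> J \<noteq> I"
proof -
  define a where "a = Inf I"
  have "open I" "is_interval I" using sol by (auto simp: is_solution_def)
  have less: "a < t" if t: "t \<in> I" for t
  proof -
    from \<open>open I\<close> t obtain e where "e > 0" "cball t e \<subseteq> I" by (meson open_contains_cball)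
    then have "t - e \<in> I" by (auto simp: subset_iff dist_real_def)
    then have "a \<le> t - e" unfolding a_def using \<open>bdd_below I\<close> by (rule cInf_lower)
    then show ?thesis using \<open>e > 0\<close> by simp
  qed
  have sub: "{a<..c} \<subseteq> I"
  proof
    fix t assume "t \<in> {a<..c}"
    then obtain s where "s \<in> I" "s < t"
      using cInf_less_iff[OF _ \<open>bdd_below I\<close>, of t] \<open>c \<in> I\<close> unfolding a_def by auto
    then show "t \<in> I" using mem_interval[OF _ \<open>c \<in> I\<close>] \<open>t \<in> {a<..c}\<close> by auto
  qed
  have bdd: "bounded ((\<lambda>t. (q t, velocity q t)) ` {a<..c})"
  proof (rule phase_bounded[OF _ _ sub])
    fix t assume t: "t \<in> {a<..c}"
    have "energy U (q t) (velocity q t) - m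
        \<le> exp (2 * k * (c - t)) * (energy U (q c) (velocity q c) - m)"
      using energy_past[OF m _ \<open>c \<in> I\<close>] sub t by auto
    \<comment> \<open>The exponential is replaced by its value at the endpoint \<open>a\<close> to
      obtain a bound uniform in \<open>t\<close>; this uses that the energy at \<open>c\<close> is
      at least \<open>m\<close>.\<close>
    also have "\<dots> \<le> exp (2 * k * (c - a)) * (energy U (q c) (velocity q c) - m)"
      using t k m[of "q c"] by (intro mult_right_mono) (auto simp: energy_def add_increasing)
    finally show "(norm (velocity q t))\<^sup>2 \<le> 2 * (exp (2 * k * (c - a)) * (energy U (q c) (velocity q c) - m))"
      using m[of "q t"] by (simp add: energy_def[of U "q t"])
  qed auto
  from autonomous_extend_left[OF phase_field_lipschitz_on_cball[OF smooth] phase_derivative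
      \<open>open I\<close> _ sub less[OF \<open>c \<in> I\<close>] bdd] less
  obtain h w where h: "h > 0" and w: "\<forall>t\<in>I. w t = (q t, velocity q t)"
    and wd: "\<forall>t\<in>I \<union> {a-h<..a}. (w has_vector_derivative phase_field k U (w t)) (at t)"
    by blast
  define J where "J = I \<union> {a-h<..a}"
  have J1: "J = I \<union> {a-h<..<c}" and J2: "J = I \<union> {a-h<..c}"
    using sub less[OF \<open>c \<in> I\<close>] \<open>c \<in> I\<close> unfolding J_def by (auto simp: subset_iff)
  have "open J" unfolding J1 using \<open>open I\<close> by (simp add: open_Un)
  moreover have "is_interval J"
    unfolding is_interval_connected_1 J2
    using \<open>is_interval I\<close> \<open>c \<in> I\<close> less[OF \<open>c \<in> I\<close>] h
    by (intro connected_Un) (auto simp: is_interval_connected_1)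
  ultimately have "is_solution k U J (fst \<circ> w)"
    using wd \<open>c \<in> I\<close> by (intro is_solution_fst) (auto simp: J_def)
  moreover have "a \<in> J" "a \<notin> I" using h less by (auto simp: J_def)
  moreover have "I \<subseteq> J" by (simp add: J_def)
  ultimately show ?thesis using w by (intro exI[of _ J] exI[of _ "fst \<circ> w"]) auto
qed

text \<open>By the energy balance, \<open>?F\<close> is an antiderivative of the squared speed. It
  is nondecreasing and bounded above by \<open>- m / k\<close>, hence converges at infinity, and the
  integral of the nonnegative integrand is the finite increment of \<open>?F\<close>.\<close>

lemma velocity_square_integrable:
  assumes m: "\<And>x. m \<le> U x" and "I = UNIV"
  shows "set_integrable lborel {t0..} (\<lambda>s. (norm (velocity q s))\<^sup>2)"
proof -
  let ?F = "\<lambda>t. - energy U (q t) (velocity q t) / k"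
  have "m \<le> energy U (q t) (velocity q t)" for t
    using m[of "q t"] unfolding energy_def by (rule add_increasing[rotated]) simp
  then have F_le: "?F t \<le> - m / k" for t
    using k by (intro divide_right_mono) simp_all
  have mono: "mono ?F"
  proof (intro monoI divide_right_mono)
    show "- energy U (q s) (velocity q s) \<le> - energy U (q t) (velocity q t)" if "s \<le> t" for s t
      using energy_nonincreasing[of s t] that \<open>I = UNIV\<close> by simp
  qed (use k in simp)
  have lim: "(?F \<longlongrightarrow> (SUP t. ?F t)) at_top"
  proof (rule increasing_tendsto)
    have bdd: "bdd_above (range ?F)" using F_le by (rule bdd_aboveI2)
    then show "\<forall>\<^sub>F t in at_top. ?F t \<le> (SUP t. ?F t)" by (intro always_eventually allI cSUP_upper) auto
    fix x assume "x < (SUP t. ?F t)"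
    then obtain s where "x < ?F s" using less_cSUP_iff[OF _ bdd] by auto
    then show "\<forall>\<^sub>F t in at_top. x < ?F t"
      using monoD[OF mono] by (intro eventually_at_top_linorderI[of s]) (metis less_le_trans)
  qed
  have der: "(?F has_real_derivative (norm (velocity q t))\<^sup>2) (at t)" for t
    using DERIV_cdivide[OF DERIV_minus[OF energy_derivative], of t k] k \<open>I = UNIV\<close> by simp
  have "continuous_on UNIV (velocity q)"
    unfolding continuous_on_eq_continuous_at[OF open_UNIV]
    using has_vector_derivative_continuous[OF velocity_derivative] \<open>I = UNIV\<close> by blast
  then have meas [measurable]: "(\<lambda>s. (norm (velocity q s))\<^sup>2) \<in> borel_measurable borel"
    by (intro borel_measurable_continuous_onI continuous_intros)
  have "(\<integral>\<^sup>+s. ennreal ((norm (velocity q s))\<^sup>2) * indicator {t0..} s \<partial>lborel) = (SUP t. ?F t) - ?F t0"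
    by (rule nn_integral_FTC_atLeast[OF meas der _ lim]) simp
  moreover have eq: "ennreal (norm (indicator {t0..} s *\<^sub>R (norm (velocity q s))\<^sup>2))
      = ennreal ((norm (velocity q s))\<^sup>2) * indicator {t0..} s" for s
    by (simp add: indicator_def)
  ultimately have "(\<integral>\<^sup>+s. ennreal (norm (indicator {t0..} s *\<^sub>R (norm (velocity q s))\<^sup>2)) \<partial>lborel) < \<infinity>"
    by (simp add: eq)
  then show ?thesis
    unfolding set_integrable_def by (intro integrableI_bounded) auto
qed

end

theorem theorem2:
  fixes k :: real
    and U :: "real ^ 'n \<Rightarrow> real"
    and q :: "real \<Rightarrow> real ^ 'n"
    and I :: "real set"
    and U_inf :: real
  defines "U_inf \<equiv> (INF x. U x)"
  assumes "k > 0"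
    and "smooth U"
    and "bdd_below (range U)"
    and "is_maximal_solution k U I q"
  shows "I = UNIV \<and>
    (\<forall>t0.
      (\<forall>t\<ge>t0. (1/2) * (norm (velocity q t))\<^sup>2
          \<le> (1/2) * (norm (velocity q t0))\<^sup>2 + U (q t0) - U_inf) \<and>
      set_integrable lborel {t0..} (\<lambda>s. (norm (velocity q s))\<^sup>2) \<and>
      (\<forall>t\<le>t0. energy U (q t) (velocity q t) - U_inf
          \<le> exp (2 * k * (t0 - t)) * (energy U (q t0) (velocity q t0) - U_inf)) \<and>
      (\<forall>t\<le>t0. (norm (velocity q t))\<^sup>2
          \<le> exp (2 * k * (t0 - t)) * ((norm (velocity q t0))\<^sup>2 + 2 * U (q t0) - 2 * U_inf)))"
proof -
  \<comment> \<open>Boundedness below makes the real-valued \<open>INF\<close> a genuine lower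
    bound.\<close>
  have m: "U_inf \<le> U x" for x
    unfolding U_inf_def using assms(4) by (rule cINF_lower) simp
  have sol: "is_solution k U I q"
    and max: "\<And>J p. is_solution k U J p \<Longrightarrow> I \<subseteq> J \<Longrightarrow> \<forall>t\<in>I. p t = q t \<Longrightarrow> J = I"
    using assms(5) unfolding is_maximal_solution_def by blast+
  note ctx = \<open>k > 0\<close> \<open>smooth U\<close> sol
  obtain c where c: "c \<in> I" using sol by (auto simp: is_solution_def)
  have "\<not> bdd_above I" using solution_extends_right[OF ctx m c] max by metis
  moreover have "\<not> bdd_below I" using solution_extends_left[OF ctx m c] max by metis
  \<comment> \<open>Being unbounded on both sides, \<open>I\<close> has points on either side of
    \<open>t\<close>, and an interval contains everything between its points.\<close>
  ultimately have "t \<in> I" for t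
    using mem_interval[OF ctx] unfolding bdd_above_def bdd_below_def by (meson linear)
  then have I: "I = UNIV" by blast
  have past: "energy U (q t) (velocity q t) - U_inf
      \<le> exp (2 * k * (t0 - t)) * (energy U (q t0) (velocity q t0) - U_inf)" if "t \<le> t0" for t t0
    using energy_past[OF ctx m] that I by simp
  have "(norm (velocity q t))\<^sup>2
      \<le> exp (2 * k * (t0 - t)) * ((norm (velocity q t0))\<^sup>2 + 2 * U (q t0) - 2 * U_inf)"
    if "t \<le> t0" for t t0
  proof -
    have "(norm (velocity q t))\<^sup>2 \<le> 2 * (energy U (q t) (velocity q t) - U_inf)"
      using m[of "q t"] by (simp add: energy_def)
    also have "\<dots> \<le> 2 * (exp (2 * k * (t0 - t)) * (energy U (q t0) (velocity q t0) - U_inf))"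
      using past[OF that] by simp
    finally show ?thesis by (simp add: energy_def algebra_simps)
  qed
  \<comment> \<open>The kinetic energy at \<open>t\<close> is the total energy minus
    \<open>U (q t)\<close>; the energy is at most that at \<open>t0\<close>, and
    \<open>U (q t)\<close> is at least \<open>U_inf\<close>.\<close>
  moreover have "(1/2) * (norm (velocity q t))\<^sup>2
      \<le> (1/2) * (norm (velocity q t0))\<^sup>2 + U (q t0) - U_inf" if "t0 \<le> t" for t t0
    using energy_nonincreasing[OF ctx, of t0 t] that I m[of "q t"] by (simp add: energy_def)
  ultimately show ?thesis
    using I past velocity_square_integrable[OF ctx m I] by blast
qed

end
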